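(* Let $R$ be a factorial domain, $K$ a field of quotients of $R$, $X$ an indeterminate over $K$ and $\mathcal{P}$ a system of representatives of $\mathcal{A}(R)$. Let $(\mathcal{P}_i)_{i\in\mathbb{N}}$ be a sequence of finite subsets of $\mathcal{P}$ such that for every $i\in\mathbb{N}$ there is some $p\in\mathcal{P}_i$ for which $$i<|\mathcal{P}_i|=|\{r+pR\mid r\in\mathcal{P}_i\}|=|R/pR|<|R/qR|<\infty\quad\text{for all }q\in\mathcal{P}_i\setminus\{p\}.$$ Then $\rho({\rm Int}(R))={\rm t}({\rm Int}(R))=\infty$.
   Context: $\mathcal{A}(R)$ is the set of atoms (irreducible = prime elements) of $R$; a system of representatives of $\mathcal{A}(R)$ is a subset containing exactly one element from each class of associated atoms. ${\rm Int}(R)=\{g\in K[X]\mid g(x)\in R\text{ for all }x\in R\}$; invariants of ${\rm Int}(R)$ are those of the multiplicative monoid $H={\rm Int}(R)^{\bullet}={\rm Int}(R)\setminus\{0\}$ (which is atomic). For an atomic (commutative, cancellative) monoid $H$, let $H_{\rm red}=\{aH^{\times}\mid a\in H\}$, let $\mathsf{Z}(H)$ be the free abelian monoid with basis $\mathcal{A}(H_{\rm red})$, and for $a\in H$ let $\mathsf{Z}(a)\subseteq\mathsf{Z}(H)$ be the set of factorizations of $a$, i.e. elements of $\mathsf{Z}(H)$ whose product in $H_{\rm red}$ is $aH^{\times}$. For $z\in\mathsf{Z}(H)$, $|z|$ is its length. The elasticity is $\rho(H)=\sup\{|z|/|z'|\mid a\in H\setminus H^{\times},\ z,z'\in\mathsf{Z}(a)\}$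 (and $\rho(H)=1$ if $H=H^{\times}$). The distance of $z,z'\in\mathsf{Z}(H)$ is $\max\{|z/g|,|z'/g|\}$ with $g=\gcd(z,z')$ in $\mathsf{Z}(H)$. For $a\in H$ and $x\in\mathsf{Z}(H)$, ${\rm t}(a,x)$ is the smallest $N\in\mathbb{N}_0\cup\{\infty\}$ such that: if $\mathsf{Z}(a)\cap x\mathsf{Z}(H)\neq\emptyset$ and $z\in\mathsf{Z}(a)$, then there is some $z'\in\mathsf{Z}(a)\cap x\mathsf{Z}(H)$ whose distance to $z$ is at most $N$. The tame degree is ${\rm t}(H)=\sup\{{\rm t}(a,u)\mid a\in H,\ u\in\mathcal{A}(H_{\rm red})\}$. *)

theory Defs
  imports
    "HOL-Algebra.Ring_Divisibility"
    "HOL-Computational_Algebra.Polynomial"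
    "HOL-Library.Multiset"
    "HOL-Library.Extended_Nat"
    "HOL-Library.Extended_Real"
begin

section \<open>Factorization invariants of a commutative cancellative monoid\<close>

text \<open>The library predicate does not itself require its argument to lie in the carrier.\<close>

definition atoms :: "('a, 'm) monoid_scheme \<Rightarrow> 'a set" where
  "atoms H = {a \<in> carrier H. Divisibility.irreducible H a}"

definition reduced_monoid :: "('a, 'm) monoid_scheme \<Rightarrow> 'a set monoid" where
  "reduced_monoid H =
    \<lparr>carrier = (\<lambda>a. a <#\<^bsub>H\<^esub> Units H) ` carrier H,
     mult = (\<lambda>A B. A <#>\<^bsub>H\<^esub> B),
     one = Units H\<rparr>"

text \<open>The free abelian monoid on the atoms of the reduced monoid is written additively, as the
  multisets of such atoms: the length of a factorization is its \<open>size\<close>, the greatest common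
  divisor of two factorizations is their intersection, and an atom \<open>u\<close> is embedded as the
  singleton \<open>{#u#}\<close>.\<close>

definition factorization_monoid :: "('a, 'm) monoid_scheme \<Rightarrow> 'a set multiset set" where
  "factorization_monoid H = {z. set_mset z \<subseteq> atoms (reduced_monoid H)}"

definition factorization_product ::
    "('a, 'm) monoid_scheme \<Rightarrow> 'a set multiset \<Rightarrow> 'a set" where
  "factorization_product H z =
    (\<Otimes>\<^bsub>reduced_monoid H\<^esub>u\<in>set_mset z. u [^]\<^bsub>reduced_monoid H\<^esub> count z u)"

definition factorizations :: "('a, 'm) monoid_scheme \<Rightarrow> 'a \<Rightarrow> 'a set multiset set" where
  "factorizations H a =
    {z \<in> factorization_monoid H. factorization_product H z = a <#\<^bsub>H\<^esub> Units H}"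

text \<open>A non-unit has no empty factorization, so the quotient below never has denominator \<open>0\<close>.\<close>

definition elasticity :: "('a, 'm) monoid_scheme \<Rightarrow> ereal" where
  "elasticity H =
    (if carrier H = Units H then 1
     else Sup {ereal (real (size z) / real (size z')) | z z' a.
       a \<in> carrier H - Units H \<and> z \<in> factorizations H a \<and> z' \<in> factorizations H a})"

definition factorization_distance :: "'b multiset \<Rightarrow> 'b multiset \<Rightarrow> nat" where
  "factorization_distance z z' = max (size (z - z \<inter># z')) (size (z' - z \<inter># z'))"

definition factorizations_through ::
    "('a, 'm) monoid_scheme \<Rightarrow> 'a \<Rightarrow> 'a set multiset \<Rightarrow> 'a set multiset set" where
  "factorizations_through H a x =
    factorizations H a \<inter> {x + y | y. y \<in> factorization_monoid H}"

definition tame_degree_at ::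
    "('a, 'm) monoid_scheme \<Rightarrow> 'a \<Rightarrow> 'a set multiset \<Rightarrow> enat" where
  "tame_degree_at H a x =
    (LEAST N::enat. \<forall>z. factorizations_through H a x \<noteq> {} \<and> z \<in> factorizations H a \<longrightarrow>
      (\<exists>z' \<in> factorizations_through H a x. enat (factorization_distance z z') \<le> N))"

definition tame_degree :: "('a, 'm) monoid_scheme \<Rightarrow> enat" where
  "tame_degree H =
    Sup {tame_degree_at H a {#u#} | a u. a \<in> carrier H \<and> u \<in> atoms (reduced_monoid H)}"

section \<open>Domains inside a field and their integer-valued polynomials\<close>

text \<open>The domain \<open>R\<close> is a subset of its quotient field, and the field is a whole type.\<close>

definition ring_on :: "'a::comm_ring_1 set \<Rightarrow> 'a ring" where
  "ring_on S = \<lparr>carrier = S, mult = (*), one = 1, zero = 0, add = (+)\<rparr>"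

definition is_quotient_field_of :: "'k::field itself \<Rightarrow> 'k set \<Rightarrow> bool" where
  "is_quotient_field_of K R \<longleftrightarrow>
    domain (ring_on R) \<and> (\<forall>x::'k. \<exists>a\<in>R. \<exists>b\<in>R - {0}. x = a / b)"

definition atom_representatives :: "('a, 'm) monoid_scheme \<Rightarrow> 'a set \<Rightarrow> bool" where
  "atom_representatives H P \<longleftrightarrow>
    P \<subseteq> atoms H \<and> (\<forall>a \<in> atoms H. \<exists>!p. p \<in> P \<and> p \<sim>\<^bsub>H\<^esub> a)"

definition residue_class :: "'k::field set \<Rightarrow> 'k \<Rightarrow> 'k \<Rightarrow> 'k set" where
  "residue_class R p r = (PIdl\<^bsub>ring_on R\<^esub> p) +>\<^bsub>ring_on R\<^esub> r"

definition residue_classes :: "'k::field set \<Rightarrow> 'k \<Rightarrow> 'k set set" where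
  "residue_classes R p = carrier (ring_on R Quot (PIdl\<^bsub>ring_on R\<^esub> p))"

definition integer_valued_polys :: "'k::field set \<Rightarrow> 'k poly set" where
  "integer_valued_polys R = {g. \<forall>x\<in>R. poly g x \<in> R}"

end

theory Submission
  imports Defs
begin

text \<open>Write \<open>S = \<P>\<^sub>i\<close> and \<open>n = |S|\<close>. As \<open>S\<close> is a complete residue system modulo \<open>p\<close>,
  \<open>f = (\<Prod>s\<in>S. X - s) / p\<close> is integer-valued, and it is an atom: a product of only some of the
  \<open>X - s\<close> takes a value prime to \<open>p\<close> at each of the remaining roots, so in a factorization neither
  of two nonconstant factors could absorb the denominator \<open>p\<close>. If a prime \<open>q\<close> divided \<open>f\<close>, the
  value at \<open>0\<close> would make \<open>q\<close> associated to an element of \<open>S - {p}\<close> (the elements of \<open>S\<close> are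
  themselves primes), while \<open>S\<close>, having fewer than \<open>|R/qR|\<close> elements, misses a residue class
  modulo \<open>q\<close>. Hence \<open>p f = (\<Prod>s\<in>S. X - s)\<close> has factorizations of lengths \<open>2\<close> and \<open>n > i\<close>, and
  the one through \<open>p\<close> shares no atom with the one into linear factors, so its distance from it is
  at least \<open>n\<close>.\<close>

section \<open>Factorizations in a cancellative monoid\<close>

context comm_monoid_cancel
begin

section \<open>Divisibility, units and atoms in the reduced monoid\<close>

abbreviation unit_class :: "'a \<Rightarrow> 'a set" where
  "unit_class a \<equiv> a <#\<^bsub>G\<^esub> Units G"

lemma unit_class_eq_iff:
  assumes "a \<in> carrier G" "b \<in> carrier G"
  shows "unit_class a = unit_class b \<longleftrightarrow> a \<sim> b"
proof
  assume eq: "unit_class a = unit_class b"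
  have "a \<otimes> \<one> \<in> unit_class a"
    unfolding l_coset_def by blast
  then obtain u where "u \<in> Units G" "a = b \<otimes> u"
    using eq assms unfolding l_coset_def by auto
  then show "a \<sim> b"
    using assms associated_iff by blast
next
  assume "a \<sim> b"
  then obtain u where u: "u \<in> Units G" "a = b \<otimes> u"
    using assms associated_iff by blast
  have "b = a \<otimes> inv u"
    using u assms by (simp add: m_assoc Units_closed)
  \<comment> \<open>This inclusion is used twice: for \<open>a = b \<otimes> u\<close> and, after
    inverting the unit, for \<open>b = a \<otimes> inv u\<close>.\<close>
  moreover have "unit_class (x \<otimes> v) \<subseteq> unit_class x" if "x \<in> carrier G" "v \<in> Units G" for x v
  proof
    fix y assume "y \<in> unit_class (x \<otimes> v)"
    then obtain w where w: "w \<in> Units G" "y = (x \<otimes> v) \<otimes> w"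
      unfolding l_coset_def by blast
    then have "y = x \<otimes> (v \<otimes> w)"
      using that by (simp add: m_assoc Units_closed)
    then show "y \<in> unit_class x"
      using that w unfolding l_coset_def by blast
  qed
  ultimately show "unit_class a = unit_class b"
    using u assms by (metis Units_inv_Units subset_antisym)
qed

lemma unit_class_mult:
  assumes "a \<in> carrier G" "b \<in> carrier G"
  shows "unit_class a <#> unit_class b = unit_class (a \<otimes> b)"
proof
  show "unit_class a <#> unit_class b \<subseteq> unit_class (a \<otimes> b)"
  proof
    fix x assume "x \<in> unit_class a <#> unit_class b"
    then obtain u v where "u \<in> Units G" "v \<in> Units G" "x = (a \<otimes> u) \<otimes> (b \<otimes> v)"
      unfolding l_coset_def set_mult_def by auto
    moreover from this have "x = (a \<otimes> b) \<otimes> (u \<otimes> v)"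
      using assms by (simp add: m_ac Units_closed)
    ultimately show "x \<in> unit_class (a \<otimes> b)"
      unfolding l_coset_def by blast
  qed
  show "unit_class (a \<otimes> b) \<subseteq> unit_class a <#> unit_class b"
  proof
    fix x assume "x \<in> unit_class (a \<otimes> b)"
    then obtain u where "u \<in> Units G" "x = (a \<otimes> \<one>) \<otimes> (b \<otimes> u)"
      using assms unfolding l_coset_def by (auto simp: m_assoc Units_closed)
    then show "x \<in> unit_class a <#> unit_class b"
      unfolding l_coset_def set_mult_def by blast
  qed
qed

lemma unit_class_one: "unit_class \<one> = Units G"
  unfolding l_coset_def by (auto simp: Units_closed)

lemma reduced_monoid_simps [simp]:
  "carrier (reduced_monoid G) = unit_class ` carrier G"
  "\<one>\<^bsub>reduced_monoid G\<^esub> = Units G"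
  "A \<otimes>\<^bsub>reduced_monoid G\<^esub> B = A <#> B"
  by (simp_all add: reduced_monoid_def)

lemma comm_monoid_reduced_monoid: "comm_monoid (reduced_monoid G)"
proof (rule comm_monoidI)
  have 1: "unit_class \<one> \<in> unit_class ` carrier G"
    by blast
  then show "\<one>\<^bsub>reduced_monoid G\<^esub> \<in> carrier (reduced_monoid G)"
    by (simp add: unit_class_one)
  show "\<one>\<^bsub>reduced_monoid G\<^esub> \<otimes>\<^bsub>reduced_monoid G\<^esub> x = x" if "x \<in> carrier (reduced_monoid G)" for x
    using that unit_class_mult[OF one_closed] by (auto simp: unit_class_one)
qed (auto simp: unit_class_mult m_ac)

text \<open>Only divisibility has to be carried over to classes: a unit is a divisor of 1, and an
  atom is described by units and proper divisors, so the next two characterizations reduce to this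
  one.\<close>

lemma unit_class_divides_iff:
  assumes "a \<in> carrier G" "b \<in> carrier G"
  shows "unit_class a divides\<^bsub>reduced_monoid G\<^esub> unit_class b \<longleftrightarrow> a divides b"
proof
  assume "unit_class a divides\<^bsub>reduced_monoid G\<^esub> unit_class b"
  then obtain c where c: "c \<in> carrier G" "unit_class b = unit_class (a \<otimes> c)"
    unfolding factor_def using assms by (auto simp: unit_class_mult)
  then have "b \<sim> a \<otimes> c"
    using assms by (simp add: unit_class_eq_iff)
  then show "a divides b"
    using c assms by (meson associated_def divides_trans dividesI m_closed)
next
  assume "a divides b"
  then obtain c where "c \<in> carrier G" "b = a \<otimes> c"
    by blast
  then show "unit_class a divides\<^bsub>reduced_monoid G\<^esub> unit_class b"
    unfolding factor_def using assms by (auto simp: unit_class_mult)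
qed

lemma unit_class_in_Units_iff:
  assumes "a \<in> carrier G"
  shows "unit_class a \<in> Units (reduced_monoid G) \<longleftrightarrow> a \<in> Units G"
proof -
  interpret red: comm_monoid "reduced_monoid G"
    by (rule comm_monoid_reduced_monoid)
  have "unit_class a \<in> Units (reduced_monoid G) \<longleftrightarrow>
      unit_class a divides\<^bsub>reduced_monoid G\<^esub> unit_class \<one>"
    using red.Unit_eq_dividesone assms by (simp add: unit_class_one)
  then show ?thesis
    using assms by (simp add: unit_class_divides_iff Unit_eq_dividesone)
qed

lemma unit_class_in_atoms_iff:
  assumes "a \<in> carrier G"
  shows "unit_class a \<in> atoms (reduced_monoid G) \<longleftrightarrow> a \<in> atoms G"
  using assms
  by (auto simp: atoms_def Divisibility.irreducible_def properfactor_def unit_class_in_Units_iff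
      unit_class_divides_iff)

lemma atoms_reduced_monoid: "atoms (reduced_monoid G) = unit_class ` atoms G"
proof -
  have "A \<in> unit_class ` carrier G" if "A \<in> atoms (reduced_monoid G)" for A
    using that by (simp add: atoms_def)
  moreover have "a \<in> carrier G" if "a \<in> atoms G" for a
    using that by (simp add: atoms_def)
  ultimately show ?thesis
    using unit_class_in_atoms_iff by fastforce
qed

section \<open>Products of factorizations\<close>

lemma factorization_product_eq_finprod:
  assumes "z \<in> factorization_monoid G" "finite S" "set_mset z \<subseteq> S"
    "S \<subseteq> carrier (reduced_monoid G)"
  shows "factorization_product G z =
    (\<Otimes>\<^bsub>reduced_monoid G\<^esub>u\<in>S. u [^]\<^bsub>reduced_monoid G\<^esub> count z u)"
proof -
  interpret red: comm_monoid "reduced_monoid G"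
    by (rule comm_monoid_reduced_monoid)
  \<comment> \<open>Enlarging the index set beyond the support adds only powers with exponent 0, so
    products with different supports can be compared over a common set.\<close>
  show ?thesis
    unfolding factorization_product_def
    by (rule red.finprod_mono_neutral_cong_left)
      (use assms in \<open>auto simp: not_in_iff simp del: reduced_monoid_simps\<close>)
qed

lemma factorization_product_empty [simp]: "factorization_product G {#} = Units G"
proof -
  interpret red: comm_monoid "reduced_monoid G"
    by (rule comm_monoid_reduced_monoid)
  show ?thesis
    using red.finprod_empty by (simp add: factorization_product_def)
qed

lemma factorization_monoid_subset_carrier:
  "z \<in> factorization_monoid G \<Longrightarrow> set_mset z \<subseteq> carrier (reduced_monoid G)"
  unfolding factorization_monoid_def atoms_def by blast

lemma factorization_product_closed:
  assumes "z \<in> factorization_monoid G"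
  shows "factorization_product G z \<in> carrier (reduced_monoid G)"
proof -
  interpret red: comm_monoid "reduced_monoid G"
    by (rule comm_monoid_reduced_monoid)
  show ?thesis
    unfolding factorization_product_def
    by (rule red.finprod_closed)
      (use factorization_monoid_subset_carrier[OF assms] in \<open>auto simp del: reduced_monoid_simps\<close>)
qed

lemma factorization_product_add_mset:
  assumes "u \<in> atoms (reduced_monoid G)" "z \<in> factorization_monoid G"
  shows "factorization_product G (add_mset u z) = u <#> factorization_product G z"
proof -
  interpret red: comm_monoid "reduced_monoid G"
    by (rule comm_monoid_reduced_monoid)
  let ?M = "reduced_monoid G"
  let ?S = "insert u (set_mset z)"
  have S: "?S \<subseteq> carrier ?M"
    using assms factorization_monoid_subset_carrier by (auto simp: atoms_def)
  have uz: "add_mset u z \<in> factorization_monoid G"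
    using assms by (simp add: factorization_monoid_def)
  have "factorization_product G (add_mset u z) =
      (\<Otimes>\<^bsub>?M\<^esub>v\<in>?S. v [^]\<^bsub>?M\<^esub> count (add_mset u z) v)"
    using uz S by (intro factorization_product_eq_finprod) auto
  \<comment> \<open>The set \<open>?S\<close> contains \<open>u\<close> whether or not
    \<open>u\<close> already occurs in \<open>z\<close>. The extra occurrence becomes a factor that
    is \<open>u\<close> at one index and the identity elsewhere, and the product then splits in
    two.\<close>
  also have "\<dots> = (\<Otimes>\<^bsub>?M\<^esub>v\<in>?S. (if u = v then v else \<one>\<^bsub>?M\<^esub>) \<otimes>\<^bsub>?M\<^esub> v [^]\<^bsub>?M\<^esub> count z v)"
  proof (rule red.finprod_cong')
    show "(\<lambda>v. (if u = v then v else \<one>\<^bsub>?M\<^esub>) \<otimes>\<^bsub>?M\<^esub> v [^]\<^bsub>?M\<^esub> count z v) \<in> ?S \<rightarrow> carrier ?M"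
      using S by (auto simp del: reduced_monoid_simps intro!: red.m_closed red.nat_pow_closed)
    fix v assume "v \<in> ?S"
    then have "v \<in> carrier ?M"
      using S by blast
    then show "v [^]\<^bsub>?M\<^esub> count (add_mset u z) v =
        (if u = v then v else \<one>\<^bsub>?M\<^esub>) \<otimes>\<^bsub>?M\<^esub> v [^]\<^bsub>?M\<^esub> count z v"
      using red.nat_pow_Suc2[of v "count z v"] red.l_one[of "v [^]\<^bsub>?M\<^esub> count z v"]
        red.nat_pow_closed[of v "count z v"]
      by (simp del: reduced_monoid_simps red.l_one nat_pow_Suc)
  qed simp
  also have "\<dots> = (\<Otimes>\<^bsub>?M\<^esub>v\<in>?S. if u = v then v else \<one>\<^bsub>?M\<^esub>) \<otimes>\<^bsub>?M\<^esub>
      (\<Otimes>\<^bsub>?M\<^esub>v\<in>?S. v [^]\<^bsub>?M\<^esub> count z v)"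
    by (rule red.finprod_multf)
      (use S in \<open>auto simp: Pi_iff simp del: reduced_monoid_simps intro!: red.nat_pow_closed\<close>)
  also have "(\<Otimes>\<^bsub>?M\<^esub>v\<in>?S. if u = v then v else \<one>\<^bsub>?M\<^esub>) = u"
    using S by (intro red.finprod_singleton) auto
  also have "(\<Otimes>\<^bsub>?M\<^esub>v\<in>?S. v [^]\<^bsub>?M\<^esub> count z v) = factorization_product G z"
    using S assms(2) by (intro factorization_product_eq_finprod[symmetric]) auto
  finally show ?thesis
    by simp
qed

text \<open>Several indices may give associated atoms; the image multiset keeps one entry per index,
  so its size is always \<open>card S\<close>.\<close>

lemma factorization_product_image_mset_set:
  assumes "finite S" "f ` S \<subseteq> atoms G"
  shows "factorization_product G (image_mset (\<lambda>s. unit_class (f s)) (mset_set S)) =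
    unit_class (finprod G f S)"
  using assms
proof (induction S rule: finite_induct)
  case empty
  then show ?case
    by (simp add: unit_class_one)
next
  case (insert s S)
  have f: "f ` insert s S \<subseteq> carrier G"
    using insert.prems by (auto simp: atoms_def)
  have "unit_class (f s) \<in> atoms (reduced_monoid G)"
    using insert.prems by (auto simp: atoms_reduced_monoid)
  moreover have "image_mset (\<lambda>s. unit_class (f s)) (mset_set S) \<in> factorization_monoid G"
    using insert.prems insert.hyps by (auto simp: factorization_monoid_def atoms_reduced_monoid)
  ultimately show ?case
    using insert f
    by (simp add: factorization_product_add_mset unit_class_mult image_subset_iff Pi_iff
        finprod_closed)
qed

text \<open>Deleting one occurrence of the class of \<open>b\<close> leaves a factorization whose
  product serves as cofactor.\<close>

lemma factor_of_factorization_divides: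
  assumes z: "z \<in> factorizations G a" and a: "a \<in> carrier G"
    and b: "b \<in> carrier G" "unit_class b \<in># z"
  shows "b divides a"
proof -
  obtain y where y: "z = add_mset (unit_class b) y"
    using b(2) by (metis insert_DiffM)
  have fm: "y \<in> factorization_monoid G" and u: "unit_class b \<in> atoms (reduced_monoid G)"
    using z unfolding factorizations_def factorization_monoid_def y by auto
  have "unit_class b <#> factorization_product G y = unit_class a"
    using z factorization_product_add_mset[OF u fm] by (simp add: factorizations_def y)
  then have "unit_class b divides\<^bsub>reduced_monoid G\<^esub> unit_class a"
    using factorization_product_closed[OF fm]
    by (intro dividesI'[where c = "factorization_product G y"]) simp_all
  then show ?thesis
    using a b(1) by (simp add: unit_class_divides_iff)
qed

section \<open>Lower bounds for the elasticity and the tame degree\<close>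

lemma elasticity_ge:
  assumes "a \<in> carrier G" "a \<notin> Units G" "z \<in> factorizations G a" "z' \<in> factorizations G a"
  shows "ereal (real (size z) / real (size z')) \<le> elasticity G"
proof -
  have "carrier G \<noteq> Units G"
    using assms by blast
  then show ?thesis
    unfolding elasticity_def using assms by (auto intro!: Sup_upper)
qed

lemma tame_degree_ge:
  assumes "a \<in> carrier G" "u \<in> atoms (reduced_monoid G)" "z \<in> factorizations G a"
    and "factorizations_through G a {#u#} \<noteq> {}"
    and far: "\<And>z'. z' \<in> factorizations_through G a {#u#} \<Longrightarrow> n \<le> factorization_distance z z'"
  shows "enat n \<le> tame_degree G"
proof -
  let ?T = "factorizations_through G a {#u#}"
  let ?P = "\<lambda>N::enat. \<forall>z. ?T \<noteq> {} \<and> z \<in> factorizations G a \<longrightarrow>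
      (\<exists>z' \<in> ?T. enat (factorization_distance z z') \<le> N)"
  \<comment> \<open>Infinity always satisfies the condition, so the least value defining the tame
    degree at \<open>a\<close> exists and satisfies it too.\<close>
  have "?P \<infinity>"
    by auto
  then have "?P (tame_degree_at G a {#u#})"
    unfolding tame_degree_at_def by (rule LeastI)
  then obtain z' where "z' \<in> ?T" "enat (factorization_distance z z') \<le> tame_degree_at G a {#u#}"
    using assms by blast
  with far have "enat n \<le> tame_degree_at G a {#u#}"
    by (meson enat_ord_simps(1) order_trans)
  also have "\<dots> \<le> tame_degree G"
    unfolding tame_degree_def using assms by (auto intro!: Sup_upper)
  finally show ?thesis .
qed

text \<open>One identity serves both bounds. Its two sides are factorizations of lengths 2 and
  \<open>card S\<close>; for the tame degree one starts from the longer one, with which no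
  factorization through \<open>p\<close> can share an atom.\<close>

lemma two_atoms_eq_finprod_atoms:
  assumes p: "p \<in> atoms G" and q: "q \<in> atoms G"
    and S: "finite S" "f ` S \<subseteq> atoms G"
    and eq: "p \<otimes> q = finprod G f S"
    and nassoc: "\<And>s. s \<in> S \<Longrightarrow> \<not> f s \<sim> p" "\<And>s. s \<in> S \<Longrightarrow> \<not> f s \<sim> q"
  shows "ereal (real (card S) / 2) \<le> elasticity G" and "enat (card S) \<le> tame_degree G"
proof -
  define z where "z = image_mset (\<lambda>s. unit_class (f s)) (mset_set S)"
  define z0 where "z0 = {#unit_class p, unit_class q#}"
  have carr: "p \<in> carrier G" "q \<in> carrier G" "p \<otimes> q \<in> carrier G"
    using p q by (auto simp: atoms_def)
  have fS: "f s \<in> carrier G" if "s \<in> S" for s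
    using S that by (auto simp: atoms_def)
  have clat: "unit_class p \<in> atoms (reduced_monoid G)" "unit_class q \<in> atoms (reduced_monoid G)"
    using p q by (auto simp: atoms_reduced_monoid)
  have [simp]: "{#} \<in> factorization_monoid G" "{#unit_class q#} \<in> factorization_monoid G"
    using clat by (auto simp: factorization_monoid_def)
  have z: "z \<in> factorizations G (p \<otimes> q)"
    using S eq factorization_product_image_mset_set[OF S]
    by (auto simp: factorizations_def factorization_monoid_def z_def atoms_reduced_monoid)
  have unit_class_Units: "unit_class b <#> Units G = unit_class b" if "b \<in> carrier G" for b
    using that unit_class_mult[of b \<one>] by (simp add: unit_class_one)
  have "factorization_product G z0 = unit_class p <#> unit_class q"
    unfolding z0_def using clat carr by (simp add: factorization_product_add_mset unit_class_Units)
  then have z0: "z0 \<in> factorizations G (p \<otimes> q)"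
    using clat carr
    by (simp add: factorizations_def factorization_monoid_def z0_def unit_class_mult)
  have "p \<otimes> q \<notin> Units G"
    using p unit_factor[OF _ carr(1,2)] unfolding atoms_def Divisibility.irreducible_def by blast
  from elasticity_ge[OF carr(3) this z z0] show "ereal (real (card S) / 2) \<le> elasticity G"
    by (simp add: z_def z0_def)
  have "card S \<le> factorization_distance z z'"
    if z': "z' \<in> factorizations_through G (p \<otimes> q) {#unit_class p#}" for z'
  proof -
    obtain y where y: "z' = add_mset (unit_class p) y" "y \<in> factorization_monoid G"
      and z'f: "z' \<in> factorizations G (p \<otimes> q)"
      using z' by (auto simp: factorizations_through_def)
    obtain b where b: "b \<in> carrier G" "factorization_product G y = unit_class b"
      using factorization_product_closed[OF y(2)] by auto
    have "unit_class (p \<otimes> b) = unit_class (p \<otimes> q)"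
      using z'f factorization_product_add_mset[OF clat(1) y(2)] b carr
      by (simp add: factorizations_def y(1) unit_class_mult)
    \<comment> \<open>Cancelling \<open>p\<close> shows that the remaining part \<open>y\<close> is
      a factorization of \<open>q\<close> alone.\<close>
    then have "p \<otimes> b \<sim> p \<otimes> q"
      using b carr by (simp add: unit_class_eq_iff)
    then have "b \<sim> q"
      using b carr by (simp add: associated_def)
    then have yq: "y \<in> factorizations G q"
      using y(2) b carr by (simp add: factorizations_def unit_class_eq_iff)
    have "unit_class (f s) \<notin># z'" if s: "s \<in> S" for s
    proof
      assume "unit_class (f s) \<in># z'"
      moreover have "unit_class (f s) \<noteq> unit_class p"
        using nassoc(1)[OF s] fS[OF s] carr by (simp add: unit_class_eq_iff)
      ultimately have "unit_class (f s) \<in># y"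
        by (simp add: y(1))
      \<comment> \<open>A nonunit divisor of the atom \<open>q\<close> is associated to
        \<open>q\<close>, which is excluded for every \<open>f s\<close>.\<close>
      then have "f s divides q"
        using factor_of_factorization_divides[OF yq carr(2) fS[OF s]] by (simp add:)
      moreover have "f s \<notin> Units G"
        using S s by (auto simp: atoms_def Divisibility.irreducible_def)
      ultimately show False
        using q fS[OF s] nassoc(2)[OF s] divides_irreducible_condition
        by (metis (no_types, lifting) atoms_def mem_Collect_eq)
    qed
    then have "z \<inter># z' = {#}"
      by (auto simp: z_def disjunct_not_in S(1))
    \<comment> \<open>With a trivial gcd nothing is removed from \<open>z\<close>, so the distance
      is at least its size.\<close>
    then show ?thesis
      by (simp add: factorization_distance_def z_def)
  qed
  moreover have "z0 \<in> factorizations_through G (p \<otimes> q) {#unit_class p#}"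
    using z0 by (auto simp: factorizations_through_def z0_def)
  ultimately show "enat (card S) \<le> tame_degree G"
    using tame_degree_ge[OF carr(3) clat(1) z] by blast
qed

end

section \<open>Integer-valued polynomials over a factorial domain\<close>

lemma ring_on_simps [simp]:
  "carrier (ring_on S) = S" "mult (ring_on S) = (*)" "\<one>\<^bsub>ring_on S\<^esub> = 1"
  "\<zero>\<^bsub>ring_on S\<^esub> = 0" "add (ring_on S) = (+)"
  by (simp_all add: ring_on_def)

lemma divides_ring_on_iff: "a divides\<^bsub>ring_on S\<^esub> b \<longleftrightarrow> (\<exists>c\<in>S. b = a * c)"
  by (simp add: factor_def)

lemma Units_ring_on_iff: "x \<in> Units (ring_on S) \<longleftrightarrow> x \<in> S \<and> (\<exists>y\<in>S. x * y = 1)"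
  by (auto simp: Units_def mult.commute)

lemma domain_ring_onI:
  fixes S :: "'a::idom set"
  assumes "0 \<in> S" "1 \<in> S" "\<And>x y. x \<in> S \<Longrightarrow> y \<in> S \<Longrightarrow> x + y \<in> S"
    "\<And>x y. x \<in> S \<Longrightarrow> y \<in> S \<Longrightarrow> x * y \<in> S" "\<And>x. x \<in> S \<Longrightarrow> - x \<in> S"
  shows "domain (ring_on S)"
proof (rule domainI)
  show "cring (ring_on S)"
  proof (rule cringI)
    show "abelian_group (ring_on S)"
    proof (rule abelian_groupI)
      fix x assume "x \<in> carrier (ring_on S)"
      then have "- x \<in> S" "- x + x = 0"
        using assms(5) by simp_all
      then show "\<exists>y\<in>carrier (ring_on S). y \<oplus>\<^bsub>ring_on S\<^esub> x = \<zero>\<^bsub>ring_on S\<^esub>"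
        by (metis ring_on_simps(1,4,5))
    qed (simp_all add: assms ac_simps)
    show "Group.comm_monoid (ring_on S)"
      by (rule comm_monoidI) (simp_all add: assms ac_simps)
  qed (simp add: distrib_right)
qed auto

text \<open>The abstract additive inverse of the ring solves the same equation as the negative in
  the surrounding type and therefore equals it.\<close>

lemma minus_closed_ring_on:
  assumes "ring (ring_on S)" "x \<in> S"
  shows "- x \<in> S"
proof -
  interpret ring "ring_on S"
    by fact
  have "\<ominus>\<^bsub>ring_on S\<^esub> x \<in> S" "\<ominus>\<^bsub>ring_on S\<^esub> x + x = 0"
    using a_inv_closed[of x] l_neg[of x] assms(2) by auto
  then show ?thesis
    by (metis eq_neg_iff_add_eq_0)
qed

lemma residue_class_eq: "residue_class R p r = (\<lambda>x. x * p + r) ` R"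
  by (auto simp: residue_class_def a_r_coset_def r_coset_def cgenideal_def)

lemma residue_classes_eq: "residue_classes R p = residue_class R p ` R"
  by (auto simp: residue_classes_def FactRing_def A_RCOSETS_def RCOSETS_def residue_class_def
      a_r_coset_def)

text \<open>Unique factorization over the field, made explicit: a root of the product is a root of
  \<open>g\<close> or of \<open>h\<close>, so the induction cancels its linear factor on that side.
  \<open>A\<close> collects the roots given to \<open>g\<close>.\<close>

lemma mult_eq_smult_prod_linear:
  fixes g h :: "'a::field poly"
  assumes "finite S" "k \<noteq> 0" "g * h = smult k (\<Prod>s\<in>S. [:- s, 1:])"
  shows "\<exists>A c d. A \<subseteq> S \<and> g = smult c (\<Prod>s\<in>A. [:- s, 1:]) \<and>
    h = smult d (\<Prod>s\<in>S - A. [:- s, 1:]) \<and> c * d = k"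
  using assms(1,3)
proof (induction S arbitrary: g h rule: finite_induct)
  case empty
  then have gh: "g * h = [:k:]"
    by simp
  then have "g \<noteq> 0" "h \<noteq> 0"
    using assms(2) by auto
  then have "degree g + degree h = 0"
    using gh by (metis degree_mult_eq degree_pCons_0)
  then obtain c d where "g = [:c:]" "h = [:d:]"
    by (metis add_is_0 degree_eq_zeroE)
  then show ?case
    using gh by auto
next
  case (insert s S)
  let ?l = "[:- s, 1:]"
  have gh: "g * h = ?l * smult k (\<Prod>s\<in>S. [:- s, 1:])"
    using insert by simp
  have "poly (g * h) s = 0"
    by (simp add: gh)
  then consider "poly g s = 0" | "poly h s = 0"
    by auto
  then show ?case
  proof cases
    case 1
    then obtain g' where g': "g = ?l * g'"
      using poly_eq_0_iff_dvd by blast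
    then have "?l * (g' * h) = ?l * smult k (\<Prod>s\<in>S. [:- s, 1:])"
      using gh by (simp only: mult.assoc)
    then have "g' * h = smult k (\<Prod>s\<in>S. [:- s, 1:])"
      by (simp only: mult_cancel_left) simp
    then obtain A c d where A: "A \<subseteq> S" "g' = smult c (\<Prod>s\<in>A. [:- s, 1:])"
      "h = smult d (\<Prod>s\<in>S - A. [:- s, 1:])" "c * d = k"
      using insert.IH by blast
    have "insert s S - insert s A = S - A" "s \<notin> A" "finite A" "insert s A \<subseteq> insert s S"
      using insert.hyps A(1) finite_subset by auto
    moreover from this have "g = smult c (\<Prod>s\<in>insert s A. [:- s, 1:])"
      using A(2) g' by simp
    ultimately show ?thesis
      using A(3,4) by metis
  next
    case 2
    then obtain h' where h': "h = ?l * h'"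
      using poly_eq_0_iff_dvd by blast
    then have "?l * (g * h') = ?l * smult k (\<Prod>s\<in>S. [:- s, 1:])"
      using gh by (simp only: mult.left_commute)
    then have "g * h' = smult k (\<Prod>s\<in>S. [:- s, 1:])"
      by (simp only: mult_cancel_left) simp
    then obtain A c d where A: "A \<subseteq> S" "g = smult c (\<Prod>s\<in>A. [:- s, 1:])"
      "h' = smult d (\<Prod>s\<in>S - A. [:- s, 1:])" "c * d = k"
      using insert.IH by blast
    have "insert s S - A = insert s (S - A)" "s \<notin> S - A" "finite (S - A)" "A \<subseteq> insert s S"
      using insert.hyps A(1) by auto
    moreover from this have "h = smult d (\<Prod>s\<in>insert s S - A. [:- s, 1:])"
      using A(3) h' by simp
    ultimately show ?thesis
      using A(2,4) by blast
  qed
qed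

section \<open>Congruences and prime elements in a factorial domain\<close>

locale factorial_subdomain =
  fixes R :: "'k::field set"
  assumes factorial: "factorial_domain (ring_on R)"
begin

sublocale R: factorial_domain "ring_on R"
  by (rule factorial)

lemma closed:
  "0 \<in> R" "1 \<in> R"
  "x \<in> R \<Longrightarrow> y \<in> R \<Longrightarrow> x + y \<in> R"
  "x \<in> R \<Longrightarrow> y \<in> R \<Longrightarrow> x * y \<in> R"
  "x \<in> R \<Longrightarrow> - x \<in> R"
  "x \<in> R \<Longrightarrow> y \<in> R \<Longrightarrow> x - y \<in> R"
proof -
  show minus: "- x \<in> R" if "x \<in> R" for x
    using that minus_closed_ring_on R.ring_axioms by blast
  show add: "x + y \<in> R" if "x \<in> R" "y \<in> R" for x y
    using that R.a_closed by simp
  show "x - y \<in> R" if "x \<in> R" "y \<in> R" for x y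
    using add[OF that(1) minus[OF that(2)]] by simp
qed (use R.zero_closed R.one_closed R.m_closed in auto)

lemma prod_closed: "(\<And>s. s \<in> S \<Longrightarrow> g s \<in> R) \<Longrightarrow> (\<Prod>s\<in>S. g s) \<in> R"
  by (induction S rule: infinite_finite_induct) (auto simp: closed)

lemma residue_class_eq_iff:
  assumes "p \<in> R" "r \<in> R" "s \<in> R"
  shows "residue_class R p r = residue_class R p s \<longleftrightarrow> p divides\<^bsub>ring_on R\<^esub> (r - s)"
proof
  assume "residue_class R p r = residue_class R p s"
  moreover have "0 * p + r \<in> residue_class R p r"
    unfolding residue_class_eq using closed by blast
  ultimately obtain x where "x \<in> R" "r = x * p + s"
    unfolding residue_class_eq by auto
  then show "p divides\<^bsub>ring_on R\<^esub> (r - s)"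
    by (auto simp: divides_ring_on_iff)
next
  \<comment> \<open>One inclusion suffices, since it can be applied with the shift \<open>c\<close>
    and with the shift \<open>- c\<close>.\<close>
  have sub: "residue_class R p (s' + p * c) \<subseteq> residue_class R p s'" if "c \<in> R" for c s'
  proof
    fix y assume "y \<in> residue_class R p (s' + p * c)"
    then obtain x where "x \<in> R" "y = (x + c) * p + s'"
      by (auto simp: residue_class_eq algebra_simps)
    then show "y \<in> residue_class R p s'"
      unfolding residue_class_eq using that closed by blast
  qed
  assume "p divides\<^bsub>ring_on R\<^esub> (r - s)"
  then obtain c where "c \<in> R" "r - s = p * c"
    by (auto simp: divides_ring_on_iff)
  then have "r = s + p * c" "s = r + p * (- c)" "c \<in> R" "- c \<in> R"
    by (auto simp: closed algebra_simps)
  then show "residue_class R p r = residue_class R p s"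
    by (metis sub subset_antisym)
qed

text \<open>Atoms live in the monoid of nonzero elements, whereas divisibility and primality are
  used in the ring itself; factoriality makes atoms prime there.\<close>

lemma atomsD:
  assumes "p \<in> atoms (mult_of (ring_on R))"
  shows "p \<in> R" "p \<noteq> 0" "p \<notin> Units (ring_on R)" "Divisibility.prime (ring_on R) p"
    and "\<And>a b. a \<in> R \<Longrightarrow> b \<in> R \<Longrightarrow> p = a * b \<Longrightarrow> a \<in> Units (ring_on R) \<or> b \<in> Units (ring_on R)"
proof -
  show p: "p \<in> R" "p \<noteq> 0"
    using assms by (auto simp: atoms_def)
  have irr: "Divisibility.irreducible (mult_of (ring_on R)) p"
    using assms by (simp add: atoms_def)
  then have "ring_irreducible\<^bsub>ring_on R\<^esub> p"
    using p by (intro R.ring_irreducibleI') auto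
  then show "p \<notin> Units (ring_on R)"
    and "\<And>a b. a \<in> R \<Longrightarrow> b \<in> R \<Longrightarrow> p = a * b \<Longrightarrow> a \<in> Units (ring_on R) \<or> b \<in> Units (ring_on R)"
    using R.ring_irreducibleE[of p] p by simp_all
  show "Divisibility.prime (ring_on R) p"
    using R.prime_eq_prime_mult R.irreducible_prime irr p by simp
qed

lemma atom_divides_mult:
  assumes "p \<in> atoms (mult_of (ring_on R))" "a \<in> R" "b \<in> R" "p divides\<^bsub>ring_on R\<^esub> (a * b)"
  shows "p divides\<^bsub>ring_on R\<^esub> a \<or> p divides\<^bsub>ring_on R\<^esub> b"
  using atomsD(4)[OF assms(1)] assms(2-) by (auto simp: Divisibility.prime_def)

lemma atom_divides_prod:
  assumes "p \<in> atoms (mult_of (ring_on R))" "finite S" "\<And>s. s \<in> S \<Longrightarrow> g s \<in> R"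
    and "p divides\<^bsub>ring_on R\<^esub> (\<Prod>s\<in>S. g s)"
  shows "\<exists>s\<in>S. p divides\<^bsub>ring_on R\<^esub> g s"
  using assms(2-)
proof (induction S rule: finite_induct)
  case empty
  then show ?case
    using atomsD(1,3)[OF assms(1)] by (auto simp: divides_ring_on_iff Units_ring_on_iff)
next
  case (insert s S)
  then show ?case
    using atom_divides_mult[OF assms(1), of "g s" "\<Prod>s\<in>S. g s"] prod_closed[of S g] by auto
qed

lemma atom_divisor_exists:
  assumes "c \<in> R" "c \<noteq> 0" "c \<notin> Units (ring_on R)"
  shows "\<exists>q \<in> atoms (mult_of (ring_on R)). q divides\<^bsub>ring_on R\<^esub> c"
proof -
  obtain fs where fs: "set fs \<subseteq> R - {0}" "factors (mult_of (ring_on R)) fs c"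
    using R.factors_exist[of c] assms by auto
  \<comment> \<open>An empty list of factors would force \<open>c\<close> to be 1, a unit. So there
    is a first entry, and the product of the others is its cofactor.\<close>
  have "fs \<noteq> []"
    using fs(2) assms(3) closed(2) by (auto simp: factors_def Units_ring_on_iff)
  then obtain q gs where q: "fs = q # gs"
    by (cases fs) auto
  have "foldr (*) gs 1 \<in> R" if "set gs \<subseteq> R" for gs
    using that by (induction gs) (auto simp: closed)
  then have "q divides\<^bsub>ring_on R\<^esub> c"
    using fs by (auto simp: q factors_def divides_ring_on_iff)
  moreover have "q \<in> atoms (mult_of (ring_on R))"
    using fs by (auto simp: q factors_def atoms_def)
  ultimately show ?thesis
    by blast
qed

text \<open>The cofactor of \<open>q\<close> in \<open>r\<close> must be a unit, since
  \<open>q\<close> is not, and inverting it reverses the divisibility.\<close>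

lemma atom_divides_atom:
  assumes "q \<in> atoms (mult_of (ring_on R))" "r \<in> atoms (mult_of (ring_on R))"
    and "q divides\<^bsub>ring_on R\<^esub> r"
  shows "r divides\<^bsub>ring_on R\<^esub> q"
proof -
  obtain c where c: "c \<in> R" "r = q * c"
    using assms(3) by (auto simp: divides_ring_on_iff)
  then have "c \<in> Units (ring_on R)"
    using atomsD(5)[OF assms(2) _ c] atomsD(1,3)[OF assms(1)] by blast
  then obtain d where d: "d \<in> R" "c * d = 1"
    by (auto simp: Units_ring_on_iff)
  have "q = r * d"
    using d(2) by (simp add: c(2) mult.assoc)
  then show ?thesis
    using d(1) by (auto simp: divides_ring_on_iff)
qed

lemma divides_ring_on_trans:
  "a divides\<^bsub>ring_on R\<^esub> b \<Longrightarrow> b divides\<^bsub>ring_on R\<^esub> c \<Longrightarrow> a divides\<^bsub>ring_on R\<^esub> c"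
  using closed(4) by (force simp: divides_ring_on_iff mult.assoc)

section \<open>The ring of integer-valued polynomials and its atoms\<close>

abbreviation IntR :: "'k poly set" where
  "IntR \<equiv> integer_valued_polys R"

lemma poly_in: "g \<in> IntR \<Longrightarrow> x \<in> R \<Longrightarrow> poly g x \<in> R"
  by (simp add: integer_valued_polys_def)

lemma const_in_IntR_iff: "[:c:] \<in> IntR \<longleftrightarrow> c \<in> R"
  using closed(1) by (auto simp: integer_valued_polys_def)

sublocale I: domain "ring_on IntR"
  by (rule domain_ring_onI) (auto simp: integer_valued_polys_def closed)

lemma degree_0_in_IntR:
  assumes "g \<in> IntR" "degree g = 0"
  obtains c where "c \<in> R" "g = [:c:]"
  using assms const_in_IntR_iff by (metis degree_eq_zeroE)

text \<open>Degrees add over the field, so both factors of 1 are constants, and the constants in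
  \<open>IntR\<close> are those from \<open>R\<close>.\<close>

lemma Units_IntR_iff: "g \<in> Units (ring_on IntR) \<longleftrightarrow> (\<exists>c \<in> Units (ring_on R). g = [:c:])"
proof
  assume "g \<in> Units (ring_on IntR)"
  then obtain h where gh: "g \<in> IntR" "h \<in> IntR" "g * h = 1"
    by (auto simp: Units_ring_on_iff)
  then have "g \<noteq> 0" "h \<noteq> 0"
    by auto
  then have "degree g + degree h = 0"
    using gh by (metis degree_1 degree_mult_eq)
  then obtain c d where "c \<in> R" "g = [:c:]" "d \<in> R" "h = [:d:]"
    using gh degree_0_in_IntR by (metis add_is_0)
  then show "\<exists>c \<in> Units (ring_on R). g = [:c:]"
    using gh(3) by (auto simp: Units_ring_on_iff one_pCons mult.commute)
next
  assume "\<exists>c \<in> Units (ring_on R). g = [:c:]"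
  then obtain c d where "c \<in> R" "g = [:c:]" "d \<in> R" "c * d = 1"
    by (auto simp: Units_ring_on_iff)
  then show "g \<in> Units (ring_on IntR)"
    unfolding Units_ring_on_iff
    by (intro conjI bexI[where x = "[:d:]"]) (simp_all add: const_in_IntR_iff one_pCons mult.commute)
qed

lemma atoms_IntRI:
  assumes "f \<in> IntR" "f \<noteq> 0" "f \<notin> Units (ring_on IntR)"
    and "\<And>g h. g \<in> IntR \<Longrightarrow> h \<in> IntR \<Longrightarrow> f = g * h \<Longrightarrow>
      g \<in> Units (ring_on IntR) \<or> h \<in> Units (ring_on IntR)"
  shows "f \<in> atoms (mult_of (ring_on IntR))"
proof -
  have "ring_irreducible\<^bsub>ring_on IntR\<^esub> f"
    by (rule I.ring_irreducibleI) (use assms in auto)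
  then show ?thesis
    using I.ring_irreducibleE(3)[of f] assms by (simp add: atoms_def)
qed

text \<open>A factor of degree 0 in \<open>IntR\<close> is an element of \<open>R\<close> and is
  handled by arithmetic in \<open>R\<close>. This is kept apart from factors of positive degree
  because a nonconstant polynomial may well have a nonunit constant divisor.\<close>

lemma nonconst_atoms_IntRI:
  assumes f: "f \<in> IntR" "degree f > 0"
    and const: "\<And>c h. c \<in> R \<Longrightarrow> h \<in> IntR \<Longrightarrow> f = smult c h \<Longrightarrow> c \<in> Units (ring_on R)"
    and nonconst: "\<And>g h. g \<in> IntR \<Longrightarrow> h \<in> IntR \<Longrightarrow> f = g * h \<Longrightarrow> degree g = 0 \<or> degree h = 0"
  shows "f \<in> atoms (mult_of (ring_on IntR))"
proof (rule atoms_IntRI)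
  show "f \<noteq> 0" "f \<notin> Units (ring_on IntR)"
    using f(2) by (auto simp: Units_IntR_iff)
  fix g h assume gh: "g \<in> IntR" "h \<in> IntR" "f = g * h"
  have unit: "a \<in> Units (ring_on IntR)" if ab: "a \<in> IntR" "b \<in> IntR" "f = a * b" "degree a = 0" for a b
  proof -
    obtain c where c: "c \<in> R" "a = [:c:]"
      using degree_0_in_IntR ab by metis
    then have "c \<in> Units (ring_on R)"
      using const[of c b] ab by simp
    then show ?thesis
      using c by (auto simp: Units_IntR_iff)
  qed
  show "g \<in> Units (ring_on IntR) \<or> h \<in> Units (ring_on IntR)"
    using nonconst[OF gh] unit[OF gh] unit[OF gh(2,1)] gh(3) by (auto simp: mult.commute)
qed (fact f(1))

lemma const_atoms_IntR:
  assumes p: "p \<in> atoms (mult_of (ring_on R))"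
  shows "[:p:] \<in> atoms (mult_of (ring_on IntR))"
proof (rule atoms_IntRI)
  fix g h assume gh: "g \<in> IntR" "h \<in> IntR" "[:p:] = g * h"
  have "g \<noteq> 0" "h \<noteq> 0"
    using gh(3) atomsD(2)[OF p] by auto
  then have "degree g + degree h = 0"
    using gh(3) by (metis degree_mult_eq degree_pCons_0)
  then obtain c d where cd: "c \<in> R" "g = [:c:]" "d \<in> R" "h = [:d:]"
    using gh degree_0_in_IntR by (metis add_is_0)
  then have "p = c * d"
    using gh(3) by simp
  then show "g \<in> Units (ring_on IntR) \<or> h \<in> Units (ring_on IntR)"
    using atomsD(5)[OF p cd(1,3)] cd by (auto simp: Units_IntR_iff)
qed (use atomsD[OF p] in \<open>auto simp: const_in_IntR_iff Units_IntR_iff\<close>)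

lemma linear_atoms_IntR:
  assumes "r \<in> R"
  shows "[:- r, 1:] \<in> atoms (mult_of (ring_on IntR))"
proof (rule nonconst_atoms_IntRI)
  show "[:- r, 1:] \<in> IntR"
    using assms closed(6) by (simp add: integer_valued_polys_def)
next
  fix c h assume ch: "c \<in> R" "h \<in> IntR" "[:- r, 1:] = smult c h"
  \<comment> \<open>At \<open>r + 1\<close> the linear polynomial takes the value 1, so every
    constant dividing it in \<open>IntR\<close> divides 1 in \<open>R\<close>.\<close>
  have "poly [:- r, 1:] (r + 1) = c * poly h (r + 1)"
    by (simp only: ch(3) poly_smult)
  then have "c * poly h (r + 1) = 1"
    by simp
  moreover have "poly h (r + 1) \<in> R"
    using assms ch(2) closed by (intro poly_in) auto
  ultimately show "c \<in> Units (ring_on R)"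
    using ch(1) by (auto simp: Units_ring_on_iff)
next
  fix g h assume "[:- r, 1:] = g * h"
  moreover from this have "g \<noteq> 0" "h \<noteq> 0"
    by auto
  ultimately have "degree g + degree h = 1"
    by (metis degree_mult_eq degree_pCons_eq_if degree_0 one_neq_zero pCons_eq_0_iff One_nat_def)
  then show "degree g = 0 \<or> degree h = 0"
    by linarith
qed simp

text \<open>Divisibility in \<open>IntR\<close> implies divisibility over the field, so degrees can
  be used to tell nonassociated elements apart.\<close>

lemma degree_eq_of_associated:
  assumes "g \<noteq> 0" "h \<noteq> 0" "g \<sim>\<^bsub>mult_of (ring_on IntR)\<^esub> h"
  shows "degree g = degree h"
proof -
  have "g dvd h" "h dvd g"
    using assms(3) by (auto elim!: associatedE simp: factor_def intro: dvdI)
  then show ?thesis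
    using assms(1,2) dvd_imp_degree_le by (metis order_antisym)
qed

text \<open>Each residue hypothesis has its own task: \<open>cover\<close> makes the polynomial
  integer-valued, \<open>distinct\<close> excludes two nonconstant factors, and
  \<open>no_cover\<close> excludes nonunit constant divisors.\<close>

lemma divided_prod_linear_atoms_IntR:
  assumes S: "finite S" "S \<subseteq> atoms (mult_of (ring_on R))" "p \<in> S"
    and cover: "\<And>x. x \<in> R \<Longrightarrow> \<exists>s\<in>S. p divides\<^bsub>ring_on R\<^esub> (x - s)"
    and distinct: "\<And>s t. s \<in> S \<Longrightarrow> t \<in> S \<Longrightarrow> p divides\<^bsub>ring_on R\<^esub> (s - t) \<Longrightarrow> s = t"
    and no_cover: "\<And>r. r \<in> S - {p} \<Longrightarrow> \<exists>x\<in>R. \<forall>s\<in>S. \<not> r divides\<^bsub>ring_on R\<^esub> (x - s)"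
  shows "smult (1 / p) (\<Prod>s\<in>S. [:- s, 1:]) \<in> atoms (mult_of (ring_on IntR))"
proof -
  define f where "f = smult (1 / p) (\<Prod>s\<in>S. [:- s, 1:])"
  have at: "s \<in> atoms (mult_of (ring_on R))" "s \<in> R" if "s \<in> S" for s
    using S(2) that atomsD(1) by blast+
  have p0: "p \<noteq> 0"
    using at(1)[OF S(3)] atomsD(2) by blast
  have poly_f: "p * poly f x = (\<Prod>s\<in>S. x - s)" for x
    using p0 by (simp add: f_def poly_prod)
  have deg: "degree f > 0"
    using p0 S(1,3) by (auto simp: f_def degree_prod_eq_sum_degree card_gt_0_iff)
  have "f \<in> atoms (mult_of (ring_on IntR))"
  proof (rule nonconst_atoms_IntRI[OF _ deg])
    have "poly f x \<in> R" if x: "x \<in> R" for x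
    proof -
      \<comment> \<open>The root \<open>s\<close> congruent to \<open>x\<close> supplies the factor
        \<open>p\<close> that cancels the denominator.\<close>
      obtain s c where s: "s \<in> S" "c \<in> R" "x - s = p * c"
        using cover[OF x] by (auto simp: divides_ring_on_iff)
      have "p * poly f x = p * (c * (\<Prod>t\<in>S - {s}. x - t))"
        using poly_f[of x] s prod.remove[OF S(1) s(1), of "\<lambda>t. x - t"] by simp
      then have "poly f x = c * (\<Prod>t\<in>S - {s}. x - t)"
        using p0 by simp
      moreover have "(\<Prod>t\<in>S - {s}. x - t) \<in> R"
        using at(2) x closed(6) by (intro prod_closed) auto
      ultimately show ?thesis
        using s(2) closed(4) by simp
    qed
    then show "f \<in> IntR"
      by (simp add: integer_valued_polys_def)
  next
    fix c h assume ch: "c \<in> R" "h \<in> IntR" "f = smult c h"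
    show "c \<in> Units (ring_on R)"
    proof (rule ccontr)
      assume "c \<notin> Units (ring_on R)"
      moreover have "c \<noteq> 0"
        using deg ch(3) by auto
      \<comment> \<open>A nonunit constant divisor has a prime divisor \<open>q\<close>, which then
        divides every value of \<open>f\<close> on \<open>R\<close>.\<close>
      ultimately obtain q e where q: "q \<in> atoms (mult_of (ring_on R))" "e \<in> R" "c = q * e"
        using atom_divisor_exists[OF ch(1)] by (auto simp: divides_ring_on_iff)
      have prod_eq: "(\<Prod>s\<in>S. x - s) = p * (q * (e * poly h x))" for x
        using poly_f[of x] ch(3) q(3) by (simp add: mult.assoc)
      \<comment> \<open>Since \<open>p \<in> S\<close>, evaluating at \<open>0\<close> lets \<open>p\<close> cancel.\<close>
      have "p * (\<Prod>s\<in>S - {p}. 0 - s) = p * (q * (- (e * poly h 0)))"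
        using prod_eq[of 0] prod.remove[OF S(1,3), of "\<lambda>s. 0 - s"]
        by (metis (no_types, lifting) diff_0 minus_equation_iff minus_mult_left minus_mult_right)
      then have "(\<Prod>s\<in>S - {p}. 0 - s) = q * (- (e * poly h 0))"
        using p0 mult_left_cancel by blast
      moreover have "- (e * poly h 0) \<in> R"
        using q(2) poly_in[OF ch(2) closed(1)] closed by blast
      ultimately have "q divides\<^bsub>ring_on R\<^esub> (\<Prod>s\<in>S - {p}. 0 - s)"
        unfolding divides_ring_on_iff by blast
      then obtain r where r: "r \<in> S - {p}" "q divides\<^bsub>ring_on R\<^esub> (0 - r)"
        using atom_divides_prod[OF q(1), of "S - {p}" "\<lambda>s. 0 - s"] S(1) at(2) closed(1,6) by blast
      then have "q divides\<^bsub>ring_on R\<^esub> r"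
        using closed(5) unfolding divides_ring_on_iff
        by (metis diff_0 minus_equation_iff mult_minus_right)
      then have rq: "r divides\<^bsub>ring_on R\<^esub> q"
        using r(1) at(1) q(1) atom_divides_atom by blast
      \<comment> \<open>Since \<open>r\<close> divides \<open>q\<close>, it divides every value of
        the product over \<open>S\<close> on \<open>R\<close>. But \<open>x\<close> avoids all
        residue classes of \<open>S\<close> modulo \<open>r\<close>, so \<open>r\<close> divides
        none of the factors there.\<close>
      obtain x where x: "x \<in> R" "\<forall>s\<in>S. \<not> r divides\<^bsub>ring_on R\<^esub> (x - s)"
        using no_cover[OF r(1)] by blast
      have "(\<Prod>s\<in>S. x - s) = q * (p * (e * poly h x))"
        by (simp add: prod_eq)
      moreover have "p * (e * poly h x) \<in> R"
        using at(2)[OF S(3)] q(2) poly_in[OF ch(2) x(1)] closed(4) by blast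
      ultimately have "q divides\<^bsub>ring_on R\<^esub> (\<Prod>s\<in>S. x - s)"
        unfolding divides_ring_on_iff by blast
      with rq have "r divides\<^bsub>ring_on R\<^esub> (\<Prod>s\<in>S. x - s)"
        by (rule divides_ring_on_trans)
      then show False
        using atom_divides_prod[of r S "\<lambda>s. x - s"] r(1) at S(1) x closed(6) by blast
    qed
  next
    fix g h assume gh: "g \<in> IntR" "h \<in> IntR" "f = g * h"
    then obtain A c d where A: "A \<subseteq> S" "g = smult c (\<Prod>s\<in>A. [:- s, 1:])"
      "h = smult d (\<Prod>s\<in>S - A. [:- s, 1:])" "c * d = 1 / p"
      using mult_eq_smult_prod_linear[OF S(1), of "1 / p" g h] p0 by (auto simp: f_def)
    show "degree g = 0 \<or> degree h = 0"
    proof (rule ccontr)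
      assume "\<not> (degree g = 0 \<or> degree h = 0)"
      then have "A \<noteq> {}" "S - A \<noteq> {}"
        using A(2,3) by (metis degree_1 degree_smult_eq prod.empty)+
      \<comment> \<open>Evaluate each factor at a root of the other: \<open>x\<close> is a root of
        \<open>h\<close> and \<open>y\<close> a root of \<open>g\<close>. As
        \<open>c * d = 1 / p\<close>, the product \<open>u * v\<close> is \<open>p\<close> times an
        element of \<open>R\<close>, so the prime \<open>p\<close> divides a difference between an
        element of \<open>A\<close> and one of \<open>S - A\<close>, against
        \<open>distinct\<close>.\<close>
      then obtain x y where xy: "x \<in> S - A" "y \<in> A"
        by blast
      define u where "u = (\<Prod>s\<in>A. x - s)"
      define v where "v = (\<Prod>s\<in>S - A. y - s)"
      have carr: "x \<in> R" "y \<in> R" "\<And>s. s \<in> A \<Longrightarrow> s \<in> R"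
        using xy A(1) at(2) by auto
      have uv: "u \<in> R" "v \<in> R"
        unfolding u_def v_def using carr at(2) closed(6) by (auto intro!: prod_closed)
      have "poly g x * poly h y = (c * d) * (u * v)"
        by (simp add: A(2,3) u_def v_def poly_prod)
      then have "u * v = p * (poly g x * poly h y)"
        using A(4) p0 by simp
      moreover have "poly g x * poly h y \<in> R"
        using gh(1,2) carr poly_in closed(4) by blast
      ultimately have "p divides\<^bsub>ring_on R\<^esub> (u * v)"
        unfolding divides_ring_on_iff by blast
      then consider "p divides\<^bsub>ring_on R\<^esub> u" | "p divides\<^bsub>ring_on R\<^esub> v"
        using atom_divides_mult at(1)[OF S(3)] uv by blast
      then show False
      proof cases
        case 1
        then obtain s where "s \<in> A" "p divides\<^bsub>ring_on R\<^esub> (x - s)"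
          using atom_divides_prod[OF at(1)[OF S(3)], of A "\<lambda>s. x - s"] carr closed(6)
            finite_subset[OF A(1) S(1)] unfolding u_def by blast
        then show False
          using distinct[of x s] xy(1) A(1) by blast
      next
        case 2
        then obtain s where "s \<in> S - A" "p divides\<^bsub>ring_on R\<^esub> (y - s)"
          using atom_divides_prod[OF at(1)[OF S(3)], of "S - A" "\<lambda>s. y - s"] carr at(2) closed(6)
            S(1) unfolding v_def by blast
        then show False
          using distinct[of y s] xy(2) A(1) by blast
      qed
    qed
  qed
  then show ?thesis
    by (simp add: f_def)
qed

section \<open>From counting residue classes to unbounded invariants\<close>

lemma card_bounds_IntR:
  assumes S: "finite S" "S \<subseteq> atoms (mult_of (ring_on R))" "p \<in> S" "1 < card S"
    and card_S: "card S = card (residue_class R p ` S)"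
    and fin: "finite (residue_classes R p)"
    and card_p: "card (residue_class R p ` S) = card (residue_classes R p)"
    and card_q: "\<And>q. q \<in> S - {p} \<Longrightarrow> card (residue_classes R p) < card (residue_classes R q)"
  shows "ereal (real (card S) / 2) \<le> elasticity (mult_of (ring_on IntR))"
    and "enat (card S) \<le> tame_degree (mult_of (ring_on IntR))"
proof -
  let ?H = "mult_of (ring_on IntR)"
  let ?f = "smult (1 / p) (\<Prod>s\<in>S. [:- s, 1:])"
  have H: "comm_monoid_cancel ?H" "Group.comm_monoid ?H"
    by (rule I.mult_of.comm_monoid_cancel_axioms, rule I.mult_of.comm_monoid_axioms)
  have SR: "s \<in> R" if "s \<in> S" for s
    using S(2) that atomsD(1) by blast
  have p0: "p \<noteq> 0"
    using S(2,3) atomsD(2) by blast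
  \<comment> \<open>A subset of full cardinality in a finite set is the whole set, so
    \<open>S\<close> meets every class modulo \<open>p\<close>; the count also rules out
    repetitions.\<close>
  have all_classes: "residue_class R p ` S = residue_classes R p"
    using SR by (intro card_subset_eq[OF fin _ card_p]) (auto simp: residue_classes_eq)
  have inj: "inj_on (residue_class R p) S"
    using card_S S(1) by (intro eq_card_imp_inj_on) simp_all
  have f: "?f \<in> atoms ?H"
  proof (rule divided_prod_linear_atoms_IntR[OF S(1-3)])
    fix x assume x: "x \<in> R"
    then have "residue_class R p x \<in> residue_class R p ` S"
      by (simp add: all_classes residue_classes_eq)
    then show "\<exists>s\<in>S. p divides\<^bsub>ring_on R\<^esub> (x - s)"
      using residue_class_eq_iff[OF SR[OF S(3)] x] SR by blast
  next
    fix s t assume "s \<in> S" "t \<in> S" "p divides\<^bsub>ring_on R\<^esub> (s - t)"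
    then show "s = t"
      using residue_class_eq_iff[OF SR[OF S(3)] SR SR, of s t] inj by (simp add: inj_on_def)
  next
    fix r assume r: "r \<in> S - {p}"
    show "\<exists>x\<in>R. \<forall>s\<in>S. \<not> r divides\<^bsub>ring_on R\<^esub> (x - s)"
    proof (rule ccontr)
      \<comment> \<open>If \<open>S\<close> met every class modulo \<open>r\<close>, there would be
        at most \<open>card S\<close> of them, which is the number of classes modulo
        \<open>p\<close>; this contradicts the strict inequality in \<open>card_q\<close>.\<close>
      assume "\<not> ?thesis"
      then have "residue_class R r x \<in> residue_class R r ` S" if "x \<in> R" for x
        using that residue_class_eq_iff[OF SR that SR, of r] r by blast
      then have "residue_classes R r \<subseteq> residue_class R r ` S"
        by (auto simp: residue_classes_eq)
      then have "card (residue_classes R r) \<le> card S"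
        by (meson S(1) card_image_le card_mono finite_imageI order_trans)
      then show False
        using card_q[OF r] card_S card_p by linarith
    qed
  qed
  have lin: "(\<lambda>s. [:- s, 1:]) ` S \<subseteq> atoms ?H"
    using SR linear_atoms_IntR by blast
  have "finprod ?H (\<lambda>s. [:- s, 1:]) S = (\<Prod>s\<in>S. [:- s, 1:])"
    using S(1) lin
  proof (induction S rule: finite_induct)
    case (insert s S)
    have "(\<lambda>s. [:- s, 1:]) \<in> S \<rightarrow> carrier ?H" "[:- s, 1:] \<in> carrier ?H"
      using insert.prems unfolding atoms_def by blast+
    then show ?case
      using insert comm_monoid.finprod_insert[OF H(2), of S s "\<lambda>s. [:- s, 1:]"] by simp
  qed (simp add: comm_monoid.finprod_empty[OF H(2)])
  then have eq: "[:p:] \<otimes>\<^bsub>?H\<^esub> ?f = finprod ?H (\<lambda>s. [:- s, 1:]) S"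
    using p0 by simp
  \<comment> \<open>The degrees 0 and \<open>card S\<close>, the latter larger than 1, both differ
    from the degree 1 of the linear factors.\<close>
  have "degree ?f = card S"
    using p0 by (simp add: degree_prod_eq_sum_degree)
  moreover have "?f \<noteq> 0" "[:p:] \<noteq> 0"
    using p0 S(1) by auto
  ultimately have "\<not> [:- s, 1:] \<sim>\<^bsub>?H\<^esub> [:p:]" "\<not> [:- s, 1:] \<sim>\<^bsub>?H\<^esub> ?f" for s
    using degree_eq_of_associated[of "[:- s, 1:]" "[:p:]"]
      degree_eq_of_associated[of "[:- s, 1:]" ?f] S(4) by auto
  then show "ereal (real (card S) / 2) \<le> elasticity ?H" "enat (card S) \<le> tame_degree ?H"
    using comm_monoid_cancel.two_atoms_eq_finprod_atoms[OF H(1) const_atoms_IntR f S(1) lin eq] S(2,3) by blast+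
qed

end

theorem theorem6p8:
  fixes R :: "'k::field set"
    and \<P> :: "'k set"
    and Ps :: "nat \<Rightarrow> 'k set"
  assumes "factorial_domain (ring_on R)"
    and "is_quotient_field_of TYPE('k) R"
    and "atom_representatives (mult_of (ring_on R)) \<P>"
    and "\<And>i. i \<ge> 1 \<Longrightarrow> finite (Ps i) \<and> Ps i \<subseteq> \<P>"
    and "\<And>i. i \<ge> 1 \<Longrightarrow> \<exists>p \<in> Ps i.
      i < card (Ps i) \<and>
      card (Ps i) = card (residue_class R p ` Ps i) \<and>
      finite (residue_classes R p) \<and>
      card (residue_class R p ` Ps i) = card (residue_classes R p) \<and>
      (\<forall>q \<in> Ps i - {p}.
        card (residue_classes R p) < card (residue_classes R q) \<and>
        finite (residue_classes R q))"
  shows "elasticity (mult_of (ring_on (integer_valued_polys R))) = \<infinity> \<and>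
    tame_degree (mult_of (ring_on (integer_valued_polys R))) = \<infinity>"
proof -
  let ?H = "mult_of (ring_on (integer_valued_polys R))"
  interpret factorial_subdomain R
    by (rule factorial_subdomain.intro) fact
  have bounds: "\<exists>n > i. ereal (real n / 2) \<le> elasticity ?H \<and> enat n \<le> tame_degree ?H"
    if i: "i \<ge> 1" for i
  proof -
    have "finite (Ps i)" "Ps i \<subseteq> atoms (mult_of (ring_on R))"
      using assms(3) assms(4)[OF i] unfolding atom_representatives_def by blast+
    \<comment> \<open>The witness is \<open>card (Ps i)\<close>; it exceeds 1 because it exceeds
      \<open>i\<close>.\<close>
    with assms(5)[OF i] i show ?thesis
      using card_bounds_IntR[of "Ps i"] by (meson le_less_trans)
  qed
  have "elasticity ?H = \<infinity>"
  proof (rule ereal_top)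
    fix B :: real
    \<comment> \<open>The maximum with 1 keeps the index in the range of the hypotheses;
      \<open>2 * B\<close> compensates for the length 2 in the denominator.\<close>
    obtain n where n: "n > max 1 (nat \<lceil>2 * B\<rceil>)" "ereal (real n / 2) \<le> elasticity ?H"
      using bounds[of "max 1 (nat \<lceil>2 * B\<rceil>)"] by auto
    have "B \<le> real n / 2"
      using n(1) by linarith
    then show "ereal B \<le> elasticity ?H"
      using n(2) by (meson ereal_less_eq(3) order_trans)
  qed
  moreover have "tame_degree ?H = \<infinity>"
  proof (cases "tame_degree ?H")
    case (enat m)
    \<comment> \<open>A finite value \<open>m\<close> is refuted at an index at least
      \<open>m\<close>, where the lower bound exceeds it.\<close>
    then obtain n where "n > max 1 m" "enat n \<le> enat m"
      using bounds[of "max 1 m"] by auto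
    then show ?thesis
      by simp
  qed simp
  ultimately show ?thesis
    by blast
qed

end
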